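(* Let $1\leq p<\infty$. Then $RM(p,\infty)$ has a subspace isomorphic to $\ell^\infty$. Namely, there is a sequence $\{f_k\}_{k\ge 0}$ of functions in $RM(p,0)$ such that for every $\{\alpha_k\}\in\ell^\infty$ the series $\sum_{k=0}^\infty\alpha_kf_k$ converges uniformly on compact subsets of $\mathbb{D}$ and the operator $$T:\ell^\infty\to RM(p,\infty),\qquad T(\{\alpha_k\}):=\sum_{k=0}^\infty\alpha_kf_k,$$ establishes an isomorphism between $\ell^\infty$ and $T(\ell^\infty)$. Moreover, $T(\{\alpha_k\})\in RM(p,0)$ if and only if $\{\alpha_k\}\in c_0$. In particular, $\sum_{k=0}^\infty f_k\in RM(p,\infty)\setminus RM(p,0)$.
   Context: $\mathbb{D}$ is the open unit disc of $\mathbb{C}$ and $\mathcal{H}(\mathbb{D})$ is the space of holomorphic functions on $\mathbb{D}$. For $1\leq p<\infty$, $RM(p,\infty)=\{f\in\mathcal{H}(\mathbb{D}):\rho_{p,\infty}(f)<+\infty\}$, where $$\rho_{p,\infty}(f)=\operatorname{ess\,sup}_{t\in[0,2\pi)}\left(\int_0^1|f(re^{it})|^p\,dr\right)^{1/p}$$ (the essential supremum can equivalently be replaced by the supremum); it is a Banach space with norm $\rho_{p,\infty}$. The subspace $RM(p,0)$ of $RM(p,\infty)$ is $$RM(p,0)=\left\{f\in\mathcal{H}(\mathbb{D}):\lim_{\rho\to1^-}\sup_{\theta}\left(\int_\rho^1|f(re^{i\theta})|^p\,dr\right)^{1/p}=0\right\}.$$ Isomorphism means a linear bijection that is bounded with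 bounded inverse. $\ell^\infty$ and $c_0$ are the usual spaces of bounded, respectively null, sequences of complex numbers. *)

theory Defs
  imports
    "HOL-Complex_Analysis.Complex_Analysis"
    "HOL-Probability.Essential_Supremum"
    "HOL-Library.Function_Algebras"
begin

definition fun_scale :: "complex \<Rightarrow> ('a \<Rightarrow> complex) \<Rightarrow> 'a \<Rightarrow> complex" where
  "fun_scale c f = (\<lambda>x. c * f x)"

global_interpretation cfun: vector_space "fun_scale :: complex \<Rightarrow> ('a \<Rightarrow> complex) \<Rightarrow> 'a \<Rightarrow> complex"
  by standard (auto simp: fun_scale_def plus_fun_def algebra_simps)

text \<open>
  Elements of \<open>H(\<D>)\<close> are normalised to vanish outside the open unit disc, so that two of them are
  equal as HOL functions iff they agree on the disc.
\<close>

definition holo_disc :: "(complex \<Rightarrow> complex) set" where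
  "holo_disc = {f. f holomorphic_on ball 0 1 \<and> (\<forall>z. z \<notin> ball 0 1 \<longrightarrow> f z = 0)}"

text \<open>For \<open>p > 0\<close>, the \<open>p\<close>-th root on \<open>[0,\<infinity>]\<close>.\<close>

definition ennreal_root :: "real \<Rightarrow> ennreal \<Rightarrow> ennreal" where
  "ennreal_root p x = (if x = top then top else ennreal (enn2real x powr (1 / p)))"

definition radial_norm :: "real \<Rightarrow> (complex \<Rightarrow> complex) \<Rightarrow> real \<Rightarrow> real \<Rightarrow> ennreal" where
  "radial_norm p f \<rho> t =
     ennreal_root p (\<integral>\<^sup>+ r \<in> {\<rho>..<1}. ennreal (cmod (f (of_real r * cis t)) powr p) \<partial>lborel)"

definition rho_inf :: "real \<Rightarrow> (complex \<Rightarrow> complex) \<Rightarrow> ennreal" where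
  "rho_inf p f = esssup (lebesgue_on {0..<2 * pi}) (radial_norm p f 0)"

definition RM_inf :: "real \<Rightarrow> (complex \<Rightarrow> complex) set" where
  "RM_inf p = {f \<in> holo_disc. rho_inf p f < top}"

definition RM_inf_norm :: "real \<Rightarrow> (complex \<Rightarrow> complex) \<Rightarrow> real" where
  "RM_inf_norm p f = enn2real (rho_inf p f)"

definition RM_zero :: "real \<Rightarrow> (complex \<Rightarrow> complex) set" where
  "RM_zero p =
     {f \<in> holo_disc. ((\<lambda>\<rho>. SUP \<theta>\<in>{0..<2 * pi}. radial_norm p f \<rho> \<theta>) \<longlongrightarrow> 0) (at_left 1)}"

definition ell_inf :: "(nat \<Rightarrow> complex) set" where
  "ell_inf = {\<alpha>. bounded (range \<alpha>)}"

definition ell_inf_norm :: "(nat \<Rightarrow> complex) \<Rightarrow> real" where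
  "ell_inf_norm \<alpha> = (SUP k. cmod (\<alpha> k))"

definition c_null :: "(nat \<Rightarrow> complex) set" where
  "c_null = {\<alpha>. \<alpha> \<longlonglongrightarrow> 0}"

definition linear_on_set ::
  "('a \<Rightarrow> complex) set \<Rightarrow> (('a \<Rightarrow> complex) \<Rightarrow> 'b \<Rightarrow> complex) \<Rightarrow> bool" where
  "linear_on_set V T \<longleftrightarrow>
     (\<forall>x\<in>V. \<forall>y\<in>V. T (x + y) = T x + T y) \<and>
     (\<forall>c. \<forall>x\<in>V. T (fun_scale c x) = fun_scale c (T x))"

definition bounded_on_set ::
  "'a set \<Rightarrow> ('a \<Rightarrow> real) \<Rightarrow> ('b \<Rightarrow> real) \<Rightarrow> ('a \<Rightarrow> 'b) \<Rightarrow> bool" where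
  "bounded_on_set V NV NW T \<longleftrightarrow> (\<exists>C. \<forall>x\<in>V. NW (T x) \<le> C * NV x)"

definition normed_isomorphism ::
  "('a \<Rightarrow> complex) set \<Rightarrow> (('a \<Rightarrow> complex) \<Rightarrow> real) \<Rightarrow>
   ('b \<Rightarrow> complex) set \<Rightarrow> (('b \<Rightarrow> complex) \<Rightarrow> real) \<Rightarrow>
   (('a \<Rightarrow> complex) \<Rightarrow> 'b \<Rightarrow> complex) \<Rightarrow> bool" where
  "normed_isomorphism V NV W NW T \<longleftrightarrow>
     linear_on_set V T \<and> bij_betw T V W \<and>
     bounded_on_set V NV NW T \<and> bounded_on_set W NW NV (inv_into V T)"

definition series_op :: "(nat \<Rightarrow> complex \<Rightarrow> complex) \<Rightarrow> (nat \<Rightarrow> complex) \<Rightarrow> complex \<Rightarrow> complex" where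
  "series_op f \<alpha> = (\<lambda>z. \<Sum>k. \<alpha> k * f k z)"

end

theory Submission
  imports Defs
begin

text \<open>
  The functions are high powers of the linear peak functions of boundary points \<open>\<zeta>\<^sub>k = cis (\<theta> k)\<close>,
  namely \<open>f\<^sub>k(z) = n\<^sub>k\<^bsup>1/p\<^esup> ((\<zeta>\<^sub>k + z) / 2)\<^bsup>n\<^sub>k\<^esup>\<close>. The factor \<open>n\<^sub>k\<^bsup>1/p\<^esup>\<close> gives the radial \<open>L\<^sup>p\<close> norm towards
  \<open>\<zeta>\<^sub>k\<close> the order of magnitude of \<open>1\<close>, with the mass moving to the boundary as \<open>n\<^sub>k\<close> grows. Away from
  \<open>\<zeta>\<^sub>k\<close> the function decays exponentially in \<open>n\<^sub>k\<close>, so that for distinct \<open>\<zeta>\<^sub>k\<close> and large enough \<open>n\<^sub>k\<close>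
  every radius sees at most one peak and the sum of all the others is uniformly below a small \<open>\<epsilon>\<close>. Thus on
  each radius \<open>\<Sum>\<alpha>\<^sub>k f\<^sub>k\<close> is a single \<open>\<alpha>\<^sub>k f\<^sub>k\<close> up to a pointwise error \<open>\<epsilon> sup \<bar>\<alpha>\<^sub>j\<bar>\<close>. This gives both
  norm estimates; and since a bounded error contributes nothing to \<open>\<integral>\<^sub>\<rho>\<^sup>1\<close> in the limit \<open>\<rho> \<rightarrow> 1\<close>, it also
  gives the characterisation of \<open>RM(p,0)\<close>.
\<close>

subsection \<open>Radial integrals\<close>

text \<open>Without the \<open>p\<close>-th root the quantity is additive in the integrand, so all
  estimates are made here and carried back to \<open>radial_norm\<close> by
  \<open>ennreal_root_le_iff\<close>.\<close>

definition radial_integral :: "real \<Rightarrow> (complex \<Rightarrow> complex) \<Rightarrow> real \<Rightarrow> real \<Rightarrow> ennreal" where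
  "radial_integral p f \<rho> t =
     (\<integral>\<^sup>+ r \<in> {\<rho>..<1}. ennreal (cmod (f (of_real r * cis t)) powr p) \<partial>lborel)"

lemma radial_norm_eq: "radial_norm p f \<rho> t = ennreal_root p (radial_integral p f \<rho> t)"
  by (simp add: radial_norm_def radial_integral_def)

lemma ennreal_root_le_iff:
  assumes p: "0 < p" and x: "0 \<le> x"
  shows "ennreal_root p y \<le> ennreal x \<longleftrightarrow> y \<le> ennreal (x powr p)"
proof (cases y)
  case (real a)
  have "a powr (1 / p) \<le> x \<longleftrightarrow> a \<le> x powr p"
  proof
    assume "a powr (1 / p) \<le> x"
    then have "(a powr (1 / p)) powr p \<le> x powr p"
      using p by (intro powr_mono2) auto
    then show "a \<le> x powr p"
      using p real by (simp add: powr_powr)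
  next
    assume "a \<le> x powr p"
    then have "a powr (1 / p) \<le> (x powr p) powr (1 / p)"
      using p real by (intro powr_mono2) auto
    then show "a powr (1 / p) \<le> x"
      using p x by (simp add: powr_powr)
  qed
  with real x show ?thesis
    by (simp add: ennreal_root_def)
next
  case top
  then show ?thesis
    by (simp add: ennreal_root_def top_unique)
qed

lemma measurable_ennreal_root [measurable]: "ennreal_root p \<in> borel_measurable borel"
  unfolding ennreal_root_def by measurable

lemma holo_disc_borel_measurable:
  assumes "f \<in> holo_disc"
  shows "f \<in> borel_measurable borel"
proof -
  have "(\<lambda>z. if z \<in> ball 0 1 then f z else 0) \<in> borel_measurable borel"
    using assms by (intro borel_measurable_continuous_on_if)
      (auto simp: holo_disc_def holomorphic_on_imp_continuous_on)
  moreover have "(\<lambda>z. if z \<in> ball 0 1 then f z else 0) = f"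
    using assms by (auto simp: holo_disc_def)
  ultimately show ?thesis
    by simp
qed

lemma borel_measurable_ray [measurable]:
  assumes "f \<in> holo_disc"
  shows "(\<lambda>r. cmod (f (of_real r * cis t))) \<in> borel_measurable borel"
proof -
  note holo_disc_borel_measurable[OF assms, measurable]
  show ?thesis
    by measurable
qed

text \<open>Joint measurability in radius and angle makes the parameter integral measurable in the
  angle, as needed to bound \<open>esssup\<close> in \<open>rho_inf_le\<close>.\<close>

lemma borel_measurable_radial_norm:
  assumes "f \<in> holo_disc"
  shows "radial_norm p f \<rho> \<in> borel_measurable borel"
proof -
  note holo_disc_borel_measurable[OF assms, measurable]
  have [measurable]: "cis \<in> borel_measurable borel"
    by (intro borel_measurable_continuous_onI continuous_intros)
  show ?thesis
    unfolding radial_norm_def by measurable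
qed

text \<open>Convergence to 0 is unaffected by \<open>p\<close>-th powers: a bound
  \<open>\<delta>\<close> for the integral corresponds to \<open>\<delta> powr (1 / p)\<close> for
  the norm.\<close>

lemma RM_zero_iff:
  assumes p: "0 < p"
  shows "f \<in> RM_zero p \<longleftrightarrow> f \<in> holo_disc \<and>
    (\<forall>\<delta>>0. \<forall>\<^sub>F \<rho> in at_left 1. \<forall>\<theta>\<in>{0..<2 * pi}. radial_integral p f \<rho> \<theta> \<le> ennreal \<delta>)"
proof -
  let ?s = "\<lambda>\<rho>. SUP \<theta>\<in>{0..<2 * pi}. radial_norm p f \<rho> \<theta>"
  have "(?s \<longlongrightarrow> 0) (at_left 1) \<longleftrightarrow>
    (\<forall>\<delta>>0. \<forall>\<^sub>F \<rho> in at_left 1. \<forall>\<theta>\<in>{0..<2 * pi}. radial_integral p f \<rho> \<theta> \<le> ennreal \<delta>)"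
    (is "?L \<longleftrightarrow> ?R")
  proof
    assume L: ?L
    show ?R
    proof (intro allI impI)
      fix \<delta> :: real
      assume "0 < \<delta>"
      then have "\<forall>\<^sub>F \<rho> in at_left 1. ?s \<rho> < ennreal (\<delta> powr (1 / p))"
        by (intro order_tendstoD[OF L]) auto
      then show "\<forall>\<^sub>F \<rho> in at_left 1. \<forall>\<theta>\<in>{0..<2 * pi}. radial_integral p f \<rho> \<theta> \<le> ennreal \<delta>"
      proof eventually_elim
        case (elim \<rho>)
        show ?case
        proof
          fix \<theta> assume "\<theta> \<in> {0..<2 * pi}"
          then have "radial_norm p f \<rho> \<theta> \<le> ennreal (\<delta> powr (1 / p))"
            using elim by (meson SUP_upper less_imp_le order_trans)
          then show "radial_integral p f \<rho> \<theta> \<le> ennreal \<delta>"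
            using p \<open>0 < \<delta>\<close> by (simp add: radial_norm_eq ennreal_root_le_iff powr_powr)
        qed
      qed
    qed
  next
    assume R: ?R
    show ?L
    proof (rule order_tendstoI)
      fix a :: ennreal
      assume "0 < a"
      \<comment> \<open>An intermediate \<open>b\<close> is finite, hence a positive real, and turns
        the weak bound for the supremum into a strict one.\<close>
      then obtain b where b: "0 < b" "b < a"
        using dense by blast
      then obtain x where x: "b = ennreal x" "0 < x"
        by (cases b) (auto simp: ennreal_less_zero_iff top_unique)
      from R x have "\<forall>\<^sub>F \<rho> in at_left 1. \<forall>\<theta>\<in>{0..<2 * pi}. radial_integral p f \<rho> \<theta> \<le> ennreal (x powr p)"
        by simp
      then show "\<forall>\<^sub>F \<rho> in at_left 1. ?s \<rho> < a"
      proof eventually_elim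
        case (elim \<rho>)
        then have "?s \<rho> \<le> b"
          using x p by (intro SUP_least) (simp add: radial_norm_eq ennreal_root_le_iff)
        with b show ?case
          by simp
      qed
    qed simp
  qed
  then show ?thesis
    by (simp add: RM_zero_def)
qed

lemma rho_inf_le:
  assumes "f \<in> holo_disc" "0 < p" "0 \<le> C"
    and "\<And>t. radial_integral p f 0 t \<le> ennreal (C powr p)"
  shows "rho_inf p f \<le> ennreal C"
proof -
  have "radial_norm p f 0 \<in> borel_measurable (lebesgue_on {0..<2 * pi})"
    using borel_measurable_radial_norm[OF assms(1)]
    by (intro measurable_restrict_space1 measurable_completion) simp
  then show ?thesis
    unfolding rho_inf_def using assms
    by (intro esssup_I) (simp_all add: radial_norm_eq ennreal_root_le_iff)
qed

lemma AE_radial_integral_le: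
  assumes "f \<in> RM_inf p" "0 < p"
  shows "AE t in lebesgue_on {0..<2 * pi}. radial_integral p f 0 t \<le> ennreal (RM_inf_norm p f powr p)"
proof -
  have "rho_inf p f = ennreal (RM_inf_norm p f)"
    using assms by (simp add: RM_inf_norm_def RM_inf_def less_top)
  then have "AE t in lebesgue_on {0..<2 * pi}. radial_norm p f 0 t \<le> ennreal (RM_inf_norm p f)"
    unfolding rho_inf_def by (metis esssup_AE)
  then show ?thesis
    using assms by (simp add: radial_norm_eq ennreal_root_le_iff RM_inf_norm_def)
qed

text \<open>A nondegenerate interval has positive measure and cannot lie in the exceptional null
  set. In this way an essential supremum gives information on some radius close to a prescribed
  one.\<close>

lemma AE_lebesgue_on_Ico_ex:
  fixes a b c d :: real
  assumes "AE t in lebesgue_on {c..<d}. P t" "c \<le> a" "a < b" "b \<le> d"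
  shows "\<exists>t\<in>{a..<b}. P t"
proof (rule ccontr)
  assume "\<not> ?thesis"
  moreover have "AE t in lebesgue. t \<in> {c..<d} \<longrightarrow> P t"
    using assms(1) by (subst (asm) AE_restrict_space_iff) auto
  ultimately have "AE t in lebesgue. t \<notin> {a..<b}"
    using assms by (auto elim!: eventually_mono)
  then have "AE t in lborel. t \<notin> {a..<b}"
    by (simp add: AE_completion_iff)
  then have "emeasure lborel {a..<b} = 0"
    by (subst (asm) AE_iff_measurable[where N = "{a..<b}"]) auto
  with assms show False
    by simp
qed

text \<open>The sum is at most twice the larger summand. This crude bound replaces Minkowski's
  inequality, since only equivalence of norms is claimed.\<close>

lemma powr_add_le:
  fixes a b p :: real
  assumes "0 \<le> a" "0 \<le> b" "0 \<le> p"
  shows "(a + b) powr p \<le> 2 powr p * (a powr p + b powr p)"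
proof -
  have "(a + b) powr p \<le> (2 * max a b) powr p"
    using assms by (intro powr_mono2) auto
  also have "\<dots> = 2 powr p * max a b powr p"
    using assms by (simp add: powr_mult)
  also have "\<dots> \<le> 2 powr p * (a powr p + b powr p)"
    by (intro mult_left_mono) (auto simp: max_def)
  finally show ?thesis .
qed

text \<open>A pointwise error \<open>b\<close> costs only a multiple of \<open>1 - \<rho>\<close>,
  which vanishes at the boundary. It is applied in both directions: series against profile, and
  profile against series.\<close>

lemma nn_integral_powr_le:
  fixes g h :: "real \<Rightarrow> real"
  assumes h [measurable]: "h \<in> borel_measurable borel"
    and "0 \<le> p" "0 \<le> b" "\<rho> \<le> 1"
    and "\<And>r. r \<in> {\<rho>..<1} \<Longrightarrow> 0 \<le> g r" "\<And>r. r \<in> {\<rho>..<1} \<Longrightarrow> 0 \<le> h r"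
    and "\<And>r. r \<in> {\<rho>..<1} \<Longrightarrow> g r \<le> h r + b"
  shows "(\<integral>\<^sup>+ r \<in> {\<rho>..<1}. ennreal (g r powr p) \<partial>lborel) \<le>
    ennreal (2 powr p) * ((\<integral>\<^sup>+ r \<in> {\<rho>..<1}. ennreal (h r powr p) \<partial>lborel) + ennreal (b powr p * (1 - \<rho>)))"
proof -
  have "ennreal (g r powr p) * indicator {\<rho>..<1} r \<le> ennreal (2 powr p) *
     (ennreal (h r powr p) * indicator {\<rho>..<1} r + ennreal (b powr p) * indicator {\<rho>..<1} r)" for r
  proof (cases "r \<in> {\<rho>..<1}")
    case True
    have "g r powr p \<le> (h r + b) powr p"
      using assms True by (intro powr_mono2) auto
    also have "\<dots> \<le> 2 powr p * (h r powr p + b powr p)"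
      using assms True by (intro powr_add_le) auto
    finally show ?thesis
      using True by (simp flip: ennreal_plus ennreal_mult)
  qed simp
  then have "(\<integral>\<^sup>+ r \<in> {\<rho>..<1}. ennreal (g r powr p) \<partial>lborel) \<le>
     (\<integral>\<^sup>+ r. ennreal (2 powr p) *
     (ennreal (h r powr p) * indicator {\<rho>..<1} r + ennreal (b powr p) * indicator {\<rho>..<1} r) \<partial>lborel)"
    by (intro nn_integral_mono)
  also have "\<dots> = ennreal (2 powr p) * ((\<integral>\<^sup>+ r \<in> {\<rho>..<1}. ennreal (h r powr p) \<partial>lborel) +
      ennreal (b powr p) * ennreal (1 - \<rho>))"
    using \<open>\<rho> \<le> 1\<close> by (simp add: nn_integral_cmult nn_integral_add nn_integral_cmult_indicator)
  also have "ennreal (b powr p) * ennreal (1 - \<rho>) = ennreal (b powr p * (1 - \<rho>))"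
    using \<open>\<rho> \<le> 1\<close> by (simp add: ennreal_mult)
  finally show ?thesis .
qed

text \<open>The \<open>p\<close>-th power of the integrand is
  \<open>n * ((1 + r) / 2) powr (n * p)\<close>, with an elementary antiderivative. For
  \<open>\<rho> = 0\<close> the value stays between positive constants for all positive
  \<open>n\<close>, which explains the factor \<open>n powr (1 / p)\<close>.\<close>

lemma nn_integral_radial_peak:
  fixes p \<rho> :: real and n :: nat
  assumes p: "0 < p" and \<rho>: "0 \<le> \<rho>" "\<rho> \<le> 1"
  shows "(\<integral>\<^sup>+ r \<in> {\<rho>..<1}. ennreal ((real n powr (1 / p) * ((1 + r) / 2) ^ n) powr p) \<partial>lborel) =
    ennreal (2 * n / (n * p + 1) * (1 - ((1 + \<rho>) / 2) powr (n * p + 1)))"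
proof -
  define G where "G r = 2 * n / (n * p + 1) * ((1 + r) / 2) powr (n * p + 1)" for r :: real
  have np: "0 < n * p + 1"
    using p by (simp add: add_nonneg_pos)
  have "(\<integral>\<^sup>+ r \<in> {\<rho>..<1}. ennreal ((real n powr (1 / p) * ((1 + r) / 2) ^ n) powr p) \<partial>lborel) =
    (\<integral>\<^sup>+ r \<in> {\<rho>..1}. ennreal (n * ((1 + r) / 2) powr (n * p)) \<partial>lborel)"
  \<comment> \<open>The end point 1, a null set, is added to obtain a compact interval for the
    fundamental theorem of calculus.\<close>
  proof (intro nn_integral_cong_AE eventually_mono[OF AE_lborel_singleton[of 1]])
    fix r :: real
    assume r: "r \<noteq> 1"
    show "ennreal ((real n powr (1 / p) * ((1 + r) / 2) ^ n) powr p) * indicator {\<rho>..<1} r =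
      ennreal (n * ((1 + r) / 2) powr (n * p)) * indicator {\<rho>..1} r"
    proof (cases "r \<in> {\<rho>..<1}")
      case True
      with \<rho> have "0 < (1 + r) / 2"
        by auto
      then have "(real n powr (1 / p) * ((1 + r) / 2) ^ n) powr p = n * ((1 + r) / 2) powr (n * p)"
        using p by (simp add: powr_mult powr_powr flip: powr_realpow)
      then show ?thesis
        using True by auto
    qed (use r in \<open>auto simp: indicator_def\<close>)
  qed
  also have "\<dots> = ennreal (G 1 - G \<rho>)"
  proof (rule nn_integral_FTC_Icc)
    fix r assume "r \<in> {\<rho>..1}"
    then have "((\<lambda>r. ((1 + r) / 2) powr (n * p + 1)) has_real_derivative
        (n * p + 1) * ((1 + r) / 2) powr (n * p) * (1 / 2)) (at r)"
      using \<rho> by (auto intro!: derivative_eq_intros)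
    from DERIV_cmult[OF this, of "2 * n / (n * p + 1)"]
    show "(G has_real_derivative n * ((1 + r) / 2) powr (n * p)) (at r)"
      unfolding G_def using np by simp
  qed (use \<rho> in auto)
  also have "G 1 - G \<rho> = 2 * n / (n * p + 1) * (1 - ((1 + \<rho>) / 2) powr (n * p + 1))"
    by (simp add: G_def algebra_simps)
  finally show ?thesis .
qed

subsection \<open>Sums of radial peaks\<close>

text \<open>
  The bound on \<open>\<epsilon>\<close> makes the error term of the lower norm estimate, at most \<open>4 \<epsilon> S\<^sup>p\<close>, half of the main
  term \<open>S\<^sup>p / (p + 1)\<close>, where \<open>1 / (p + 1)\<close> bounds the \<open>p\<close>-th power of the radial norm of each peak from below.
\<close>

locale radial_peaks =
  fixes p \<epsilon> :: real and \<theta> d e :: "nat \<Rightarrow> real" and n :: "nat \<Rightarrow> nat"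
  assumes p: "1 \<le> p"
    and eps_pos: "0 < \<epsilon>"
    and eps: "8 * (p + 1) * \<epsilon> \<le> 1"
    and theta: "0 \<le> \<theta> k" "\<theta> k < 2 * pi"
    and d_pos: "0 < d k"
    and d_lim: "d \<longlonglongrightarrow> 0"
    and separated: "j \<noteq> k \<Longrightarrow> 2 * d j + 2 * d k \<le> dist (cis (\<theta> j)) (cis (\<theta> k))"
    and e_nonneg: "0 \<le> e k"
    and e_sums: "e sums \<epsilon>"
    and n_gt: "k < n k"
    and decay: "cmod z \<le> 1 \<Longrightarrow> d k \<le> dist z (cis (\<theta> k)) \<Longrightarrow>
      n k powr (1 / p) * (cmod (cis (\<theta> k) + z) / 2) ^ n k \<le> e k"
begin

section \<open>Peaks, their radial profiles and the separation of rays\<close>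

lemma eps_le: "8 * \<epsilon> \<le> 1"
proof -
  have "1 * \<epsilon> \<le> (p + 1) * \<epsilon>"
    using p eps_pos by (intro mult_right_mono) auto
  with eps show ?thesis
    by (simp add: algebra_simps)
qed

text \<open>The value 0 off the disc is the normalisation of \<open>holo_disc\<close>.\<close>

definition peak :: "nat \<Rightarrow> complex \<Rightarrow> complex" where
  "peak k z = (if cmod z < 1 then of_real (n k powr (1 / p)) * ((cis (\<theta> k) + z) / 2) ^ n k else 0)"

text \<open>The modulus of \<open>peak k\<close> on the radius towards
  \<open>cis (\<theta> k)\<close>; it dominates the modulus on every other radius.\<close>

definition profile :: "nat \<Rightarrow> real \<Rightarrow> real" where
  "profile k r = n k powr (1 / p) * ((1 + r) / 2) ^ n k"

lemma cmod_peak: "cmod z < 1 \<Longrightarrow> cmod (peak k z) = n k powr (1 / p) * (cmod (cis (\<theta> k) + z) / 2) ^ n k"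
  by (simp add: peak_def norm_mult norm_power norm_divide)

lemma cmod_peak_le_profile: "0 \<le> r \<Longrightarrow> r < 1 \<Longrightarrow> cmod (peak k (of_real r * cis t)) \<le> profile k r"
  unfolding profile_def
  by (subst cmod_peak)
    (auto simp: norm_mult intro!: mult_left_mono power_mono divide_right_mono order_trans[OF norm_triangle_ineq])

lemma profile_nonneg: "0 \<le> r \<Longrightarrow> 0 \<le> profile k r"
  by (simp add: profile_def)

lemma profile_le: "0 \<le> r \<Longrightarrow> r \<le> 1 \<Longrightarrow> profile k r \<le> n k powr (1 / p)"
  by (auto simp: profile_def intro!: mult_left_le power_le_one)

lemma borel_measurable_profile [measurable]: "profile k \<in> borel_measurable borel"
  unfolding profile_def by measurable

lemma peak_decay: "d k \<le> dist z (cis (\<theta> k)) \<Longrightarrow> cmod (peak k z) \<le> e k"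
  using decay[of z k] e_nonneg[of k]
  by (cases "cmod z < 1") (simp_all add: cmod_peak, simp add: peak_def)

text \<open>The point of modulus \<open>r\<close> on the ray is \<open>1 - r\<close> away from
  \<open>cis t\<close> and at least \<open>1 - r\<close> away from \<open>cis (\<theta> k)\<close>.
  By the triangle inequality its distance to \<open>cis (\<theta> k)\<close> is therefore at least
  half that of \<open>cis t\<close>; hence the factor 2.\<close>

lemma far_ray:
  assumes r: "0 \<le> r" "r \<le> 1" and *: "2 * d k \<le> dist (cis t) (cis (\<theta> k))"
  shows "d k \<le> dist (of_real r * cis t) (cis (\<theta> k))"
proof -
  have "dist (cis t) (of_real r * cis t) = cmod (of_real (1 - r) * cis t)"
    by (simp add: dist_norm algebra_simps)
  also have "\<dots> = 1 - r"
    using r by (simp add: norm_mult del: of_real_diff)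
  finally have 1: "dist (cis t) (of_real r * cis t) = 1 - r" .
  have "1 = dist 0 (cis (\<theta> k))" "dist 0 (of_real r * cis t) = r"
    using r by (auto simp: dist_norm norm_mult)
  then have "1 - r \<le> dist (of_real r * cis t) (cis (\<theta> k))"
    using dist_triangle[of 0 "cis (\<theta> k)" "of_real r * cis t"] by linarith
  moreover have "dist (cis t) (cis (\<theta> k)) \<le> dist (cis t) (of_real r * cis t) + dist (of_real r * cis t) (cis (\<theta> k))"
    by (rule dist_triangle)
  ultimately show ?thesis
    using 1 * by linarith
qed

lemma d_le_dist: "cmod z \<le> 1 - d k \<Longrightarrow> d k \<le> dist z (cis (\<theta> k))"
  using dist_triangle[of 0 "cis (\<theta> k)" z] by (simp add: dist_norm)

text \<open>By \<open>separated\<close>, the neighbourhoods of radius \<open>2 * d k\<close> of the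
  centres are disjoint, so \<open>cis t\<close> lies in at most one of them. If it lies in none, any
  \<open>k\<close> will do.\<close>

lemma ray_cases: "\<exists>k. \<forall>j. j \<noteq> k \<longrightarrow> 2 * d j \<le> dist (cis t) (cis (\<theta> j))"
proof (cases "\<exists>k. dist (cis t) (cis (\<theta> k)) < 2 * d k")
  case True
  then obtain k where k: "dist (cis t) (cis (\<theta> k)) < 2 * d k" by blast
  have "2 * d j \<le> dist (cis t) (cis (\<theta> j))" if "j \<noteq> k" for j
    using separated[OF that] k dist_triangle3[of "cis (\<theta> j)" "cis (\<theta> k)" "cis t"] by linarith
  then show ?thesis by blast
qed (auto simp: not_less)

section \<open>Convergence of the series and its dominant term on a ray\<close>

text \<open>A compact set lies in a disc of radius \<open>R < 1\<close>. As \<open>d\<close> tends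
  to 0, all but finitely many peaks are in their decay region on it, and the M-test applies with
  majorant \<open>S * e k\<close>.\<close>

lemma uniform_limit_series:
  assumes \<alpha>: "\<And>k. cmod (\<alpha> k) \<le> S" and K: "compact K" "K \<subseteq> ball 0 1"
  shows "uniform_limit K (\<lambda>m z. \<Sum>k<m. \<alpha> k * peak k z) (series_op peak \<alpha>) sequentially"
proof -
  have S: "0 \<le> S"
    using \<alpha>[of 0] norm_ge_zero order_trans by blast
  obtain R where R: "R < 1" "\<And>z. z \<in> K \<Longrightarrow> cmod z \<le> R"
  proof (cases "K = {}")
    case False
    have "\<exists>x\<in>K. \<forall>y\<in>K. cmod y \<le> cmod x"
      using K False by (intro continuous_attains_sup continuous_intros) auto
    then obtain x where "x \<in> K" "\<And>y. y \<in> K \<Longrightarrow> cmod y \<le> cmod x"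
      by blast
    with K that[of "cmod x"] show ?thesis
      by auto
  qed (use that[of 0] in auto)
  have "\<forall>\<^sub>F k in sequentially. d k < 1 - R"
    using order_tendstoD(2)[OF d_lim] R by simp
  then have "\<forall>\<^sub>F k in sequentially. \<forall>z\<in>K. cmod (\<alpha> k * peak k z) \<le> S * e k"
  proof eventually_elim
    case (elim k)
    then show ?case
      using \<alpha> S R(2) by (force simp: norm_mult intro!: mult_mono peak_decay d_le_dist)
  qed
  then have "uniform_limit K (\<lambda>m z. \<Sum>k<m. \<alpha> k * peak k z) (\<lambda>z. \<Sum>k. \<alpha> k * peak k z) sequentially"
    using e_sums by (intro Weierstrass_m_test_ev) (auto simp: summable_mult sums_iff)
  then show ?thesis
    by (simp add: series_op_def)
qed

lemma summable_series:
  assumes "\<And>k. cmod (\<alpha> k) \<le> S"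
  shows "summable (\<lambda>k. \<alpha> k * peak k z)"
proof (cases "cmod z < 1")
  case True
  then have "uniform_limit {z} (\<lambda>m z. \<Sum>k<m. \<alpha> k * peak k z) (series_op peak \<alpha>) sequentially"
    using assms by (intro uniform_limit_series) auto
  then show ?thesis
    by (auto dest!: tendsto_uniform_limitI simp: summable_iff_convergent convergent_def)
qed (simp add: peak_def)

lemma series_op_holo_disc:
  assumes "\<And>k. cmod (\<alpha> k) \<le> S"
  shows "series_op peak \<alpha> \<in> holo_disc"
proof -
  have "series_op peak \<alpha> holomorphic_on ball 0 1"
  proof (rule holomorphic_uniform_sequence)
    fix m
    have "(\<lambda>z. \<Sum>k<m. \<alpha> k * (of_real (n k powr (1 / p)) * ((cis (\<theta> k) + z) / 2) ^ n k)) holomorphic_on ball 0 1"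
      by (intro holomorphic_intros) auto
    then show "(\<lambda>z. \<Sum>k<m. \<alpha> k * peak k z) holomorphic_on ball 0 1"
      by (rule holomorphic_transform) (simp add: peak_def)
  next
    fix z :: complex
    assume "z \<in> ball 0 1"
    then obtain r where "0 < r" "cball z r \<subseteq> ball 0 1"
      using open_contains_cball open_ball by blast
    moreover from this have
      "uniform_limit (cball z r) (\<lambda>m z. \<Sum>k<m. \<alpha> k * peak k z) (series_op peak \<alpha>) sequentially"
      by (intro uniform_limit_series[where S = S] assms) auto
    ultimately show "\<exists>r>0. cball z r \<subseteq> ball 0 1 \<and>
        uniform_limit (cball z r) (\<lambda>m z. \<Sum>k<m. \<alpha> k * peak k z) (series_op peak \<alpha>) sequentially"
      by blast
  qed simp
  then show ?thesis
    by (auto simp: holo_disc_def series_op_def peak_def)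
qed

text \<open>By \<open>far_ray\<close> every other peak is in its decay region along the whole
  radius, and the bounds \<open>S * e j\<close> sum to \<open>S * \<epsilon>\<close>. The error is
  uniform in \<open>r\<close>.\<close>

lemma series_near_term:
  assumes \<alpha>: "\<And>k. cmod (\<alpha> k) \<le> S" and r: "0 \<le> r" "r \<le> 1"
    and far: "\<And>j. j \<noteq> k \<Longrightarrow> 2 * d j \<le> dist (cis t) (cis (\<theta> j))"
  shows "cmod (series_op peak \<alpha> (of_real r * cis t) - \<alpha> k * peak k (of_real r * cis t)) \<le> S * \<epsilon>"
proof -
  define z where "z = of_real r * cis t"
  define g where "g j = (if j = k then 0 else \<alpha> j * peak j z)" for j
  have S: "0 \<le> S"
    using \<alpha>[of 0] norm_ge_zero order_trans by blast
  have "(\<lambda>j. \<alpha> j * peak j z) sums series_op peak \<alpha> z"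
    unfolding series_op_def by (intro summable_sums summable_series[where S = S] \<alpha>)
  moreover have "(\<lambda>j. if j = k then \<alpha> k * peak k z else 0) sums (\<alpha> k * peak k z)"
    using sums_single[of k "\<lambda>j. \<alpha> j * peak j z"] by (simp cong: if_cong)
  ultimately have "(\<lambda>j. \<alpha> j * peak j z - (if j = k then \<alpha> k * peak k z else 0)) sums
      (series_op peak \<alpha> z - \<alpha> k * peak k z)"
    by (rule sums_diff)
  also have "(\<lambda>j. \<alpha> j * peak j z - (if j = k then \<alpha> k * peak k z else 0)) = g"
    by (auto simp: g_def)
  finally have g: "series_op peak \<alpha> z - \<alpha> k * peak k z = suminf g"
    by (simp add: sums_iff)
  have "cmod (g j) \<le> S * e j" for j
    using \<alpha>[of j] S e_nonneg far[of j] far_ray[OF r, of j t]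
    by (auto simp: g_def z_def norm_mult intro!: mult_mono peak_decay)
  then have "cmod (suminf g) \<le> (\<Sum>j. S * e j)"
    using e_sums by (intro norm_suminf_le) (auto simp: summable_mult sums_iff)
  also have "\<dots> = S * \<epsilon>"
    using e_sums by (simp add: suminf_mult sums_iff)
  finally show ?thesis
    using g by (simp add: z_def)
qed

section \<open>Radial integrals of the profiles\<close>

lemma nn_integral_profile:
  assumes "0 \<le> \<rho>" "\<rho> \<le> 1"
  shows "(\<integral>\<^sup>+ r \<in> {\<rho>..<1}. ennreal (profile k r powr p) \<partial>lborel) =
    ennreal (2 * n k / (n k * p + 1) * (1 - ((1 + \<rho>) / 2) powr (n k * p + 1)))"
  unfolding profile_def using assms p by (intro nn_integral_radial_peak) auto

lemma nn_integral_profile_le: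
  assumes "0 \<le> \<rho>" "\<rho> \<le> 1"
  shows "(\<integral>\<^sup>+ r \<in> {\<rho>..<1}. ennreal (profile k r powr p) \<partial>lborel) \<le> ennreal 2"
proof -
  have "real (n k) * 1 \<le> n k * p"
    using p by (intro mult_left_mono) auto
  then have "2 * real (n k) / (n k * p + 1) \<le> 2"
    using p by (simp add: field_simps add_nonneg_pos)
  then have "2 * n k / (n k * p + 1) * (1 - ((1 + \<rho>) / 2) powr (n k * p + 1)) \<le> 2 * 1" (is "?x \<le> _")
    using assms p by (intro mult_mono) (auto simp: powr_le1)
  then have "?x \<le> 2"
    by simp
  then show ?thesis
    unfolding nn_integral_profile[OF assms] by (rule ennreal_leI)
qed

text \<open>Complements \<open>nn_integral_profile_le\<close>: this bound vanishes as
  \<open>\<rho>\<close> tends to 1, but is not uniform in \<open>k\<close>.\<close>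

lemma nn_integral_profile_tail_le:
  assumes "0 \<le> \<rho>" "\<rho> \<le> 1"
  shows "(\<integral>\<^sup>+ r \<in> {\<rho>..<1}. ennreal (profile k r powr p) \<partial>lborel) \<le> ennreal (real (n k) * (1 - \<rho>))"
proof -
  have "profile k r powr p \<le> n k" if "r \<in> {\<rho>..<1}" for r
  proof -
    have "profile k r powr p \<le> (n k powr (1 / p)) powr p"
      using that assms p by (intro powr_mono2 profile_le profile_nonneg) auto
    then show ?thesis
      using p by (simp add: powr_powr)
  qed
  then have "(\<integral>\<^sup>+ r \<in> {\<rho>..<1}. ennreal (profile k r powr p) \<partial>lborel) \<le> (\<integral>\<^sup>+ r. ennreal (n k) * indicator {\<rho>..<1} r \<partial>lborel)"
    by (intro nn_integral_mono) (auto simp: indicator_def ennreal_leI simp del: ennreal_of_nat_eq_real_of_nat)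
  also have "\<dots> = ennreal (n k) * ennreal (1 - \<rho>)"
    using assms by (simp add: nn_integral_cmult_indicator)
  finally show ?thesis
    using assms by (simp add: ennreal_mult)
qed

text \<open>As \<open>n k\<close> is at least 1, the factor \<open>2 * n k / (n k * p + 1)\<close>
  is at least \<open>2 / (p + 1)\<close>; the last hypothesis leaves at least half of it.\<close>

lemma nn_integral_profile_ge:
  assumes "0 \<le> \<rho>" "\<rho> \<le> 1" and "((1 + \<rho>) / 2) powr (n k * p + 1) \<le> 1 / 2"
  shows "ennreal (1 / (p + 1)) \<le> (\<integral>\<^sup>+ r \<in> {\<rho>..<1}. ennreal (profile k r powr p) \<partial>lborel)"
proof -
  have "1 \<le> real (n k)"
    using n_gt[of k] by linarith
  then have "2 / (p + 1) \<le> 2 * n k / (n k * p + 1)"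
    using p by (simp add: field_simps add_nonneg_pos)
  then have "2 / (p + 1) * (1 / 2) \<le>
      2 * n k / (n k * p + 1) * (1 - ((1 + \<rho>) / 2) powr (n k * p + 1))"
    using assms p by (intro mult_mono) auto
  moreover have "2 / (p + 1) * (1 / 2) = 1 / (p + 1)"
    using p by (simp add: field_simps)
  ultimately show ?thesis
    unfolding nn_integral_profile[OF assms(1,2)] by (intro ennreal_leI) simp
qed

lemma nn_integral_profile_ge_0:
  "ennreal (1 / (p + 1)) \<le> (\<integral>\<^sup>+ r \<in> {0..<1}. ennreal (profile k r powr p) \<partial>lborel)"
proof (rule nn_integral_profile_ge)
  have "(1 / 2 :: real) powr (n k * p + 1) \<le> (1 / 2) powr 1"
    using p by (intro powr_mono') auto
  then show "((1 + 0) / 2 :: real) powr (n k * p + 1) \<le> 1 / 2"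
    by simp
qed auto

text \<open>For fixed \<open>\<rho>\<close>, \<open>n_gt\<close> forces
  \<open>((1 + \<rho>) / 2) powr (n k * p + 1)\<close> to 0: the mass of the profiles moves beyond
  \<open>\<rho>\<close>.\<close>

lemma eventually_nn_integral_profile_ge:
  assumes "0 \<le> \<rho>" "\<rho> < 1"
  shows "\<forall>\<^sub>F k in sequentially.
    ennreal (1 / (p + 1)) \<le> (\<integral>\<^sup>+ r \<in> {\<rho>..<1}. ennreal (profile k r powr p) \<partial>lborel)"
proof -
  have "(\<lambda>k. ((1 + \<rho>) / 2) ^ k) \<longlonglongrightarrow> 0"
    using assms by (intro LIMSEQ_realpow_zero) auto
  then have "\<forall>\<^sub>F k in sequentially. ((1 + \<rho>) / 2) ^ k < 1 / 2"
    by (rule order_tendstoD) simp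
  then show ?thesis
  proof eventually_elim
    case (elim k)
    have "real k \<le> real (n k) * 1"
      using n_gt[of k] by linarith
    also have "\<dots> \<le> n k * p"
      using p by (intro mult_left_mono) auto
    finally have "((1 + \<rho>) / 2) powr (n k * p + 1) \<le> ((1 + \<rho>) / 2) powr k"
      using assms by (intro powr_mono') auto
    also have "\<dots> = ((1 + \<rho>) / 2) ^ k"
      using assms by (intro powr_realpow) auto
    finally show ?case
      using elim assms by (intro nn_integral_profile_ge) auto
  qed
qed

section \<open>Two-sided estimates for radial integrals of the series\<close>

text \<open>The profile integral is left unevaluated because the norm estimate uses its uniform
  bound, while membership in \<open>RM_zero\<close> also uses the tail bound.\<close>

lemma radial_integral_series_le:
  assumes \<alpha>: "\<And>k. cmod (\<alpha> k) \<le> S" and \<rho>: "0 \<le> \<rho>" "\<rho> \<le> 1"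
    and far: "\<And>j. j \<noteq> k \<Longrightarrow> 2 * d j \<le> dist (cis t) (cis (\<theta> j))"
  shows "radial_integral p (series_op peak \<alpha>) \<rho> t \<le> ennreal (2 powr p) *
    (ennreal (cmod (\<alpha> k) powr p) * (\<integral>\<^sup>+ r \<in> {\<rho>..<1}. ennreal (profile k r powr p) \<partial>lborel) +
     ennreal ((S * \<epsilon>) powr p * (1 - \<rho>)))"
proof -
  have S: "0 \<le> S"
    using \<alpha>[of 0] norm_ge_zero order_trans by blast
  have "radial_integral p (series_op peak \<alpha>) \<rho> t \<le> ennreal (2 powr p) *
    ((\<integral>\<^sup>+ r \<in> {\<rho>..<1}. ennreal ((cmod (\<alpha> k) * profile k r) powr p) \<partial>lborel) +
     ennreal ((S * \<epsilon>) powr p * (1 - \<rho>)))"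
    unfolding radial_integral_def
  proof (rule nn_integral_powr_le)
    fix r assume r: "r \<in> {\<rho>..<1}"
    let ?z = "of_real r * cis t"
    have "cmod (series_op peak \<alpha> ?z - \<alpha> k * peak k ?z) \<le> S * \<epsilon>"
      using r \<rho> by (intro series_near_term \<alpha> far) auto
    moreover have "cmod (\<alpha> k * peak k ?z) \<le> cmod (\<alpha> k) * profile k r"
      using r \<rho> by (auto simp: norm_mult intro!: mult_left_mono cmod_peak_le_profile)
    moreover have "cmod (series_op peak \<alpha> ?z) \<le>
        cmod (series_op peak \<alpha> ?z - \<alpha> k * peak k ?z) + cmod (\<alpha> k * peak k ?z)"
      by norm
    ultimately show "cmod (series_op peak \<alpha> ?z) \<le> cmod (\<alpha> k) * profile k r + S * \<epsilon>"
      by linarith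
  qed (use p \<rho> S eps_pos in \<open>auto simp: profile_nonneg\<close>)
  also have "(\<integral>\<^sup>+ r \<in> {\<rho>..<1}. ennreal ((cmod (\<alpha> k) * profile k r) powr p) \<partial>lborel) =
    (\<integral>\<^sup>+ r. ennreal (cmod (\<alpha> k) powr p) * (ennreal (profile k r powr p) * indicator {\<rho>..<1} r) \<partial>lborel)"
    using \<rho> by (intro nn_integral_cong) (auto simp: indicator_def powr_mult profile_nonneg ennreal_mult)
  also have "\<dots> = ennreal (cmod (\<alpha> k) powr p) * (\<integral>\<^sup>+ r \<in> {\<rho>..<1}. ennreal (profile k r powr p) \<partial>lborel)"
    by (intro nn_integral_cmult) measurable
  finally show ?thesis .
qed

text \<open>The essential supremum ignores single angles, so a lower bound is needed on an interval
  of them. Uniform continuity makes its length independent of \<open>r\<close>, and staying within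
  \<open>2 * d k\<close> of the centre keeps the other peaks far away.\<close>

lemma peak_near_centre:
  "\<exists>\<eta>>0. \<theta> k + \<eta> \<le> 2 * pi \<and> (\<forall>t\<in>{\<theta> k..<\<theta> k + \<eta>}.
     (\<forall>j. j \<noteq> k \<longrightarrow> 2 * d j \<le> dist (cis t) (cis (\<theta> j))) \<and>
     (\<forall>r\<in>{0..<1}. profile k r \<le> cmod (peak k (of_real r * cis t)) + \<epsilon>))"
proof -
  \<comment> \<open>The peak without the cut-off is continuous on the closed disc, where compactness
    gives uniform continuity.\<close>
  define F where "F z = of_real (n k powr (1 / p)) * ((cis (\<theta> k) + z) / 2) ^ n k" for z
  have F: "cmod (F (of_real r * cis (\<theta> k))) = profile k r" if "r \<in> {0..<1}" for r
  proof -
    have "cis (\<theta> k) + of_real r * cis (\<theta> k) = of_real (1 + r) * cis (\<theta> k)"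
      by (simp add: algebra_simps)
    then show ?thesis
      using that by (simp add: F_def profile_def norm_mult norm_power norm_divide del: of_real_add)
  qed
  have "uniformly_continuous_on (cball 0 1) F"
    unfolding F_def by (intro compact_uniformly_continuous continuous_intros) auto
  then obtain h where h: "h > 0"
    "\<And>x y. x \<in> cball 0 1 \<Longrightarrow> y \<in> cball 0 1 \<Longrightarrow> dist y x < h \<Longrightarrow> dist (F y) (F x) < \<epsilon>"
    using eps_pos unfolding uniformly_continuous_on_def by metis
  have "continuous_on UNIV cis"
    by (intro continuous_intros)
  moreover have "0 < min h (2 * d k)"
    using h(1) d_pos[of k] by simp
  ultimately obtain s where s: "s > 0"
      "\<And>t. dist t (\<theta> k) < s \<Longrightarrow> dist (cis t) (cis (\<theta> k)) < min h (2 * d k)"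
    unfolding continuous_on_iff by (metis UNIV_I)
  show ?thesis
  \<comment> \<open>The cap \<open>2 * pi - \<theta> k\<close> keeps the interval inside
    \<open>{0..<2 * pi}\<close>; it is one-sided because \<open>\<theta> k = 0\<close> is
    allowed.\<close>
  proof (intro exI[of _ "min s (2 * pi - \<theta> k)"] conjI ballI allI impI)
    fix t j
    assume t: "t \<in> {\<theta> k..<\<theta> k + min s (2 * pi - \<theta> k)}" and "j \<noteq> k"
    then have "dist (cis t) (cis (\<theta> k)) < 2 * d k"
      using s(2)[of t] by (auto simp: dist_real_def)
    with \<open>j \<noteq> k\<close> show "2 * d j \<le> dist (cis t) (cis (\<theta> j))"
      using separated[of j k] dist_triangle3[of "cis (\<theta> j)" "cis (\<theta> k)" "cis t"]
      by linarith
  next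
    fix t r
    assume t: "t \<in> {\<theta> k..<\<theta> k + min s (2 * pi - \<theta> k)}" and r: "r \<in> {0..<1::real}"
    have "dist (of_real r * cis t) (of_real r * cis (\<theta> k)) = r * dist (cis t) (cis (\<theta> k))"
      using r unfolding dist_norm right_diff_distrib[symmetric] by (simp add: norm_mult)
    also have "\<dots> \<le> 1 * dist (cis t) (cis (\<theta> k))"
      using r by (intro mult_right_mono) auto
    also have "\<dots> < h"
      using s(2)[of t] t by (auto simp: dist_real_def)
    finally have "dist (F (of_real r * cis t)) (F (of_real r * cis (\<theta> k))) < \<epsilon>"
      using r by (intro h(2)) (auto simp: norm_mult)
    moreover have "F (of_real r * cis t) = peak k (of_real r * cis t)"
      using r by (simp add: F_def peak_def norm_mult)
    ultimately show "profile k r \<le> cmod (peak k (of_real r * cis t)) + \<epsilon>"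
      using F[OF r] norm_triangle_ineq2[of "F (of_real r * cis (\<theta> k))" "peak k (of_real r * cis t)"]
      by (simp add: dist_norm norm_minus_commute)
  qed (use s theta[of k] in auto)
qed

text \<open>One error \<open>S * \<epsilon>\<close> comes from the other terms, a second one from
  replacing the peak on a nearby ray by its profile. One interval of angles serves every
  \<open>\<rho>\<close>.\<close>

lemma radial_integral_series_ge:
  assumes \<alpha>: "\<And>k. cmod (\<alpha> k) \<le> S"
  shows "\<exists>\<eta>>0. \<theta> k + \<eta> \<le> 2 * pi \<and> (\<forall>t\<in>{\<theta> k..<\<theta> k + \<eta>}. \<forall>\<rho>\<in>{0..<1}.
    ennreal (cmod (\<alpha> k) powr p) * (\<integral>\<^sup>+ r \<in> {\<rho>..<1}. ennreal (profile k r powr p) \<partial>lborel) \<le>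
    ennreal (2 powr p) * (radial_integral p (series_op peak \<alpha>) \<rho> t +
      ennreal ((2 * S * \<epsilon>) powr p * (1 - \<rho>))))"
proof -
  have S: "0 \<le> S"
    using \<alpha>[of 0] norm_ge_zero order_trans by blast
  obtain \<eta> where "0 < \<eta>" "\<theta> k + \<eta> \<le> 2 * pi"
    and far: "\<And>t j. t \<in> {\<theta> k..<\<theta> k + \<eta>} \<Longrightarrow> j \<noteq> k \<Longrightarrow> 2 * d j \<le> dist (cis t) (cis (\<theta> j))"
    and near: "\<And>t r. t \<in> {\<theta> k..<\<theta> k + \<eta>} \<Longrightarrow> r \<in> {0..<1} \<Longrightarrow>
      profile k r \<le> cmod (peak k (of_real r * cis t)) + \<epsilon>"
    using peak_near_centre[of k] by blast
  have "ennreal (cmod (\<alpha> k) powr p) * (\<integral>\<^sup>+ r \<in> {\<rho>..<1}. ennreal (profile k r powr p) \<partial>lborel) \<le>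
    ennreal (2 powr p) * (radial_integral p (series_op peak \<alpha>) \<rho> t +
      ennreal ((2 * S * \<epsilon>) powr p * (1 - \<rho>)))"
    if t: "t \<in> {\<theta> k..<\<theta> k + \<eta>}" and \<rho>: "\<rho> \<in> {0..<1}" for t \<rho>
  proof -
    have "ennreal (cmod (\<alpha> k) powr p) * (\<integral>\<^sup>+ r \<in> {\<rho>..<1}. ennreal (profile k r powr p) \<partial>lborel) =
      (\<integral>\<^sup>+ r. ennreal (cmod (\<alpha> k) powr p) * (ennreal (profile k r powr p) * indicator {\<rho>..<1} r) \<partial>lborel)"
      by (intro nn_integral_cmult[symmetric]) measurable
    also have "\<dots> = (\<integral>\<^sup>+ r \<in> {\<rho>..<1}. ennreal ((cmod (\<alpha> k) * profile k r) powr p) \<partial>lborel)"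
      using \<rho> by (intro nn_integral_cong) (auto simp: indicator_def powr_mult profile_nonneg ennreal_mult)
    also have "\<dots> \<le> ennreal (2 powr p) * (radial_integral p (series_op peak \<alpha>) \<rho> t +
        ennreal ((2 * S * \<epsilon>) powr p * (1 - \<rho>)))"
      unfolding radial_integral_def
    proof (rule nn_integral_powr_le)
      fix r assume r: "r \<in> {\<rho>..<1}"
      let ?z = "of_real r * cis t"
      have "cmod (series_op peak \<alpha> ?z - \<alpha> k * peak k ?z) \<le> S * \<epsilon>"
        using r \<rho> t by (intro series_near_term \<alpha> far) auto
      then have "cmod (\<alpha> k) * cmod (peak k ?z) \<le> cmod (series_op peak \<alpha> ?z) + S * \<epsilon>"
        using norm_triangle_ineq3[of "series_op peak \<alpha> ?z" "\<alpha> k * peak k ?z"] by (simp add: norm_mult)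
      moreover have "cmod (\<alpha> k) * profile k r \<le> cmod (\<alpha> k) * (cmod (peak k ?z) + \<epsilon>)"
        using r \<rho> by (intro mult_left_mono near t) auto
      moreover have "cmod (\<alpha> k) * \<epsilon> \<le> S * \<epsilon>"
        using eps_pos by (intro mult_right_mono \<alpha>) auto
      ultimately show "cmod (\<alpha> k) * profile k r \<le> cmod (series_op peak \<alpha> ?z) + 2 * S * \<epsilon>"
        by (simp add: algebra_simps)
    qed (use p \<rho> S eps_pos in \<open>auto simp: profile_nonneg intro: borel_measurable_ray series_op_holo_disc[OF \<alpha>]\<close>)
    finally show ?thesis .
  qed
  with \<open>0 < \<eta>\<close> \<open>\<theta> k + \<eta> \<le> 2 * pi\<close> show ?thesis
    by blast
qed

section \<open>Equivalence of the norms\<close>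

lemma rho_inf_series_le:
  assumes \<alpha>: "\<And>k. cmod (\<alpha> k) \<le> S"
  shows "rho_inf p (series_op peak \<alpha>) \<le> ennreal ((3 * 2 powr p) powr (1 / p) * S)"
proof (rule rho_inf_le)
  show "series_op peak \<alpha> \<in> holo_disc"
    by (rule series_op_holo_disc[OF \<alpha>])
  have S: "0 \<le> S"
    using \<alpha>[of 0] norm_ge_zero order_trans by blast
  show "0 < p" "0 \<le> (3 * 2 powr p) powr (1 / p) * S"
    using p S by auto
  have "\<epsilon> \<le> 1"
    using eps_le eps_pos by linarith
  fix t
  obtain k where far: "\<And>j. j \<noteq> k \<Longrightarrow> 2 * d j \<le> dist (cis t) (cis (\<theta> j))"
    using ray_cases by blast
  have "radial_integral p (series_op peak \<alpha>) 0 t \<le> ennreal (2 powr p) *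
    (ennreal (cmod (\<alpha> k) powr p) * (\<integral>\<^sup>+ r \<in> {0..<1}. ennreal (profile k r powr p) \<partial>lborel) +
     ennreal ((S * \<epsilon>) powr p * (1 - 0)))"
    by (rule radial_integral_series_le[OF \<alpha> _ _ far]) auto
  \<comment> \<open>The profile integral is at most 2 and the error at most \<open>S powr p\<close>,
    which gives the 3 in the constant.\<close>
  also have "\<dots> \<le> ennreal (2 powr p) * (ennreal (S powr p) * ennreal 2 + ennreal (S powr p))"
    using S p \<alpha>[of k] eps_pos \<open>\<epsilon> \<le> 1\<close>
    by (intro mult_left_mono add_mono mult_mono nn_integral_profile_le ennreal_leI)
      (auto intro!: powr_mono2 mult_left_le)
  also have "\<dots> = ennreal (2 powr p * (S powr p * 2 + S powr p))"
    by (simp only: ennreal_mult ennreal_plus powr_ge_zero add_nonneg_nonneg mult_nonneg_nonneg zero_le_numeral)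
  also have "2 powr p * (S powr p * 2 + S powr p) = ((3 * 2 powr p) powr (1 / p) * S) powr p"
    using p S by (simp add: powr_mult powr_powr)
  finally show "radial_integral p (series_op peak \<alpha>) 0 t \<le> ennreal (((3 * 2 powr p) powr (1 / p) * S) powr p)" .
qed

lemma series_op_RM_inf:
  assumes "\<And>k. cmod (\<alpha> k) \<le> S"
  shows "series_op peak \<alpha> \<in> RM_inf p"
  using series_op_holo_disc[of \<alpha> S, OF assms] rho_inf_series_le[of \<alpha> S, OF assms]
  by (auto simp: RM_inf_def intro: le_less_trans)

text \<open>Each \<open>cmod (\<alpha> k) powr p\<close> is at most a multiple of
  \<open>N powr p\<close> plus an error \<open>S powr p / 2\<close>, uniformly in \<open>k\<close>.
  Taking the supremum over \<open>k\<close> allows the error to be absorbed into the left-hand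
  side.\<close>

lemma norm_series_ge:
  assumes \<alpha>: "\<alpha> \<in> ell_inf"
  shows "ell_inf_norm \<alpha> \<le> (2 * (p + 1) * 2 powr p) powr (1 / p) * RM_inf_norm p (series_op peak \<alpha>)"
proof -
  define S where "S = ell_inf_norm \<alpha>"
  define N where "N = RM_inf_norm p (series_op peak \<alpha>)"
  define X where "X = (p + 1) * 2 powr p * N powr p + S powr p / 2"
  have \<alpha>S: "cmod (\<alpha> k) \<le> S" for k
    using \<alpha> by (auto simp: ell_inf_def ell_inf_norm_def S_def bounded_iff intro!: cSUP_upper bdd_aboveI2)
  have S: "0 \<le> S"
    using \<alpha>S[of 0] norm_ge_zero order_trans by blast
  have N: "0 \<le> N"
    by (simp add: N_def RM_inf_norm_def)
  have e1: "4 * \<epsilon> \<le> 1"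
    using eps_le eps_pos by linarith
  \<comment> \<open>Since \<open>4 * \<epsilon> \<le> 1 \<le> p\<close>, the power
    \<open>(4 * \<epsilon>) powr p\<close> is at most \<open>4 * \<epsilon>\<close>, to which the
    locale assumption \<open>eps\<close> applies.\<close>
  have "2 powr p * (2 * S * \<epsilon>) powr p = (4 * \<epsilon>) powr p * S powr p"
    using S eps_pos by (simp add: ac_simps flip: powr_mult)
  also have "\<dots> \<le> (4 * \<epsilon>) powr 1 * S powr p"
    using p eps_pos e1 by (intro mult_right_mono powr_mono') auto
  finally have small: "(p + 1) * (2 powr p * (2 * S * \<epsilon>) powr p) \<le> (p + 1) * (4 * \<epsilon> * S powr p)"
    using p eps_pos by (intro mult_left_mono) auto
  have "8 * (p + 1) * \<epsilon> * (S powr p) \<le> 1 * (S powr p)"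
    by (intro mult_right_mono eps) auto
  with small have small: "(p + 1) * (2 powr p * (2 * S * \<epsilon>) powr p) \<le> S powr p / 2"
    by (simp add: algebra_simps)
  have "cmod (\<alpha> k) \<le> X powr (1 / p)" for k
  proof -
    obtain \<eta> where \<eta>: "0 < \<eta>" "\<theta> k + \<eta> \<le> 2 * pi"
      and ge: "\<And>t. t \<in> {\<theta> k..<\<theta> k + \<eta>} \<Longrightarrow>
        ennreal (cmod (\<alpha> k) powr p) * (\<integral>\<^sup>+ r \<in> {0..<1}. ennreal (profile k r powr p) \<partial>lborel) \<le>
        ennreal (2 powr p) * (radial_integral p (series_op peak \<alpha>) 0 t + ennreal ((2 * S * \<epsilon>) powr p * (1 - 0)))"
      using radial_integral_series_ge[of \<alpha> S k, OF \<alpha>S] by force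
    have "AE t in lebesgue_on {0..<2 * pi}. radial_integral p (series_op peak \<alpha>) 0 t \<le> ennreal (N powr p)"
      unfolding N_def using p by (intro AE_radial_integral_le series_op_RM_inf[OF \<alpha>S]) auto
    then have "\<exists>t\<in>{\<theta> k..<\<theta> k + \<eta>}. radial_integral p (series_op peak \<alpha>) 0 t \<le> ennreal (N powr p)"
      using \<eta> theta[of k] by (intro AE_lebesgue_on_Ico_ex) auto
    then obtain t where t: "t \<in> {\<theta> k..<\<theta> k + \<eta>}"
      "radial_integral p (series_op peak \<alpha>) 0 t \<le> ennreal (N powr p)"
      by blast
    have "ennreal (cmod (\<alpha> k) powr p) * ennreal (1 / (p + 1)) \<le>
      ennreal (cmod (\<alpha> k) powr p) * (\<integral>\<^sup>+ r \<in> {0..<1}. ennreal (profile k r powr p) \<partial>lborel)"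
      by (intro mult_left_mono nn_integral_profile_ge_0) auto
    also note ge[OF t(1)]
    also have "ennreal (2 powr p) * (radial_integral p (series_op peak \<alpha>) 0 t + ennreal ((2 * S * \<epsilon>) powr p * (1 - 0))) \<le>
      ennreal (2 powr p) * (ennreal (N powr p) + ennreal ((2 * S * \<epsilon>) powr p))"
      using t(2) by (intro mult_left_mono add_mono) auto
    finally have "cmod (\<alpha> k) powr p * (1 / (p + 1)) \<le> 2 powr p * (N powr p + (2 * S * \<epsilon>) powr p)"
      using p by (simp flip: ennreal_mult ennreal_plus)
    then have "cmod (\<alpha> k) powr p \<le> (p + 1) * (2 powr p * (N powr p + (2 * S * \<epsilon>) powr p))"
      using p by (simp add: field_simps)
    also have "\<dots> \<le> X"
      using small by (simp add: X_def algebra_simps)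
    finally have "(cmod (\<alpha> k) powr p) powr (1 / p) \<le> X powr (1 / p)"
      using p by (intro powr_mono2) auto
    then show ?thesis
      using p by (simp add: powr_powr)
  qed
  then have "S \<le> X powr (1 / p)"
    unfolding S_def ell_inf_norm_def by (intro cSUP_least) auto
  then have "S powr p \<le> (X powr (1 / p)) powr p"
    using S p by (intro powr_mono2) auto
  also have "\<dots> = X"
    using p by (simp add: powr_powr X_def)
  finally have "S powr p \<le> 2 * (p + 1) * 2 powr p * N powr p"
    by (simp add: X_def algebra_simps)
  then have "(S powr p) powr (1 / p) \<le> (2 * (p + 1) * 2 powr p * N powr p) powr (1 / p)"
    using p by (intro powr_mono2) auto
  then show ?thesis
    using p S N by (simp add: powr_powr powr_mult flip: S_def N_def)
qed

section \<open>Null sequences and the small space\<close>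

text \<open>The dominant index depends on the angle, so a bound uniform in \<open>k\<close> is
  needed. From some \<open>K\<close> on the coefficients are small and the uniform profile bound
  suffices; the finitely many earlier profiles have small tails.\<close>

lemma series_op_RM_zero:
  assumes \<alpha>: "\<And>k. cmod (\<alpha> k) \<le> S" and "\<alpha> \<longlonglongrightarrow> 0"
  shows "series_op peak \<alpha> \<in> RM_zero p"
proof -
  have S: "0 \<le> S"
    using \<alpha>[of 0] norm_ge_zero order_trans by blast
  have "\<forall>\<^sub>F \<rho> in at_left 1. \<forall>t\<in>{0..<2 * pi}. radial_integral p (series_op peak \<alpha>) \<rho> t \<le> ennreal \<delta>"
    if \<delta>: "0 < \<delta>" for \<delta>
  proof -
    \<comment> \<open>With this choice the final bound tends to
      \<open>2 powr p * (2 * \<gamma>) = \<delta> / 2\<close>.\<close>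
    define \<gamma> where "\<gamma> = \<delta> / (4 * 2 powr p)"
    have \<gamma>: "0 < \<gamma>"
      using \<delta> by (simp add: \<gamma>_def)
    have "(\<lambda>k. cmod (\<alpha> k)) \<longlonglongrightarrow> 0"
      using assms by (simp add: tendsto_norm_zero)
    then have "\<forall>\<^sub>F k in sequentially. cmod (\<alpha> k) < \<gamma> powr (1 / p)"
      by (rule order_tendstoD) (use \<gamma> in simp)
    then obtain K where K: "\<And>k. K \<le> k \<Longrightarrow> cmod (\<alpha> k) < \<gamma> powr (1 / p)"
      by (auto simp: eventually_sequentially)
    \<comment> \<open>The sum serves as a common bound for the finitely many \<open>n k\<close> with
      \<open>k < K\<close>.\<close>
    define M where "M = S powr p * (\<Sum>k<K. real (n k))"
    have M: "0 \<le> M"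
      by (auto simp: M_def intro!: mult_nonneg_nonneg sum_nonneg)
    have tail: "ennreal (cmod (\<alpha> k) powr p) * (\<integral>\<^sup>+ r \<in> {\<rho>..<1}. ennreal (profile k r powr p) \<partial>lborel) \<le>
      ennreal (2 * \<gamma> + M * (1 - \<rho>))" if \<rho>: "0 \<le> \<rho>" "\<rho> \<le> 1" for k \<rho>
    proof (cases "k < K")
      case True
      have "ennreal (cmod (\<alpha> k) powr p) * (\<integral>\<^sup>+ r \<in> {\<rho>..<1}. ennreal (profile k r powr p) \<partial>lborel) \<le>
        ennreal (S powr p) * ennreal (n k * (1 - \<rho>))"
        using \<alpha>[of k] \<rho> p by (intro mult_mono ennreal_leI powr_mono2 nn_integral_profile_tail_le) auto
      also have "\<dots> = ennreal (S powr p * (n k * (1 - \<rho>)))"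
        using \<rho> by (intro ennreal_mult[symmetric]) auto
      also have "S powr p * (n k * (1 - \<rho>)) = S powr p * n k * (1 - \<rho>)"
        by simp
      also have "\<dots> \<le> ennreal (M * (1 - \<rho>))"
        unfolding M_def using True \<rho>
        by (intro ennreal_leI mult_right_mono mult_left_mono member_le_sum) auto
      also have "\<dots> \<le> ennreal (2 * \<gamma> + M * (1 - \<rho>))"
        using \<gamma> by (intro ennreal_leI) auto
      finally show ?thesis .
    next
      case False
      then have "cmod (\<alpha> k) powr p \<le> (\<gamma> powr (1 / p)) powr p"
        using K[of k] p by (intro powr_mono2) auto
      then have "cmod (\<alpha> k) powr p \<le> \<gamma>"
        using p \<gamma> by (simp add: powr_powr)
      then have "ennreal (cmod (\<alpha> k) powr p) * (\<integral>\<^sup>+ r \<in> {\<rho>..<1}. ennreal (profile k r powr p) \<partial>lborel) \<le>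
        ennreal \<gamma> * ennreal 2"
        using \<rho> by (intro mult_mono ennreal_leI nn_integral_profile_le) auto
      also have "\<dots> = ennreal (\<gamma> * 2)"
        using \<gamma> by (intro ennreal_mult[symmetric]) auto
      also have "\<dots> \<le> ennreal (2 * \<gamma> + M * (1 - \<rho>))"
        using M \<rho> by (intro ennreal_leI) auto
      finally show ?thesis .
    qed
    have "((\<lambda>\<rho>. 2 powr p * (2 * \<gamma> + M * (1 - \<rho>) + (S * \<epsilon>) powr p * (1 - \<rho>))) \<longlongrightarrow>
        2 powr p * (2 * \<gamma> + M * (1 - 1) + (S * \<epsilon>) powr p * (1 - 1))) (at_left 1)"
      by (intro tendsto_intros)
    moreover have "2 powr p * (2 * \<gamma> + M * (1 - 1) + (S * \<epsilon>) powr p * (1 - 1)) < \<delta>"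
      using \<delta> by (simp add: \<gamma>_def)
    ultimately have "\<forall>\<^sub>F \<rho> in at_left 1. 2 powr p * (2 * \<gamma> + M * (1 - \<rho>) + (S * \<epsilon>) powr p * (1 - \<rho>)) < \<delta>"
      by (rule order_tendstoD)
    moreover have "\<forall>\<^sub>F \<rho> in at_left 1. \<rho> \<in> {0<..<1::real}"
      by (rule eventually_at_left_real) simp
    ultimately show ?thesis
    proof eventually_elim
      case (elim \<rho>)
      then have \<rho>: "0 \<le> \<rho>" "\<rho> \<le> 1"
        by auto
      show ?case
      proof
        fix t
        obtain k where far: "\<And>j. j \<noteq> k \<Longrightarrow> 2 * d j \<le> dist (cis t) (cis (\<theta> j))"
          using ray_cases by blast
        have "radial_integral p (series_op peak \<alpha>) \<rho> t \<le> ennreal (2 powr p) *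
          (ennreal (cmod (\<alpha> k) powr p) * (\<integral>\<^sup>+ r \<in> {\<rho>..<1}. ennreal (profile k r powr p) \<partial>lborel) +
           ennreal ((S * \<epsilon>) powr p * (1 - \<rho>)))"
          by (rule radial_integral_series_le[OF \<alpha> \<rho> far])
        also have "\<dots> \<le> ennreal (2 powr p) * (ennreal (2 * \<gamma> + M * (1 - \<rho>)) + ennreal ((S * \<epsilon>) powr p * (1 - \<rho>)))"
          by (intro mult_left_mono add_right_mono tail \<rho>) auto
        also have "\<dots> = ennreal (2 powr p * (2 * \<gamma> + M * (1 - \<rho>) + (S * \<epsilon>) powr p * (1 - \<rho>)))"
          using \<gamma> M \<rho> by (simp flip: ennreal_mult ennreal_plus)
        also have "\<dots> \<le> ennreal \<delta>"
          using elim by (intro ennreal_leI) auto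
        finally show "radial_integral p (series_op peak \<alpha>) \<rho> t \<le> ennreal \<delta>" .
      qed
    qed
  qed
  then show ?thesis
    using p series_op_holo_disc[OF \<alpha>] by (subst RM_zero_iff) auto
qed

text \<open>One \<open>\<rho>\<close> is fixed first, making the radial integrals and the error
  small for all angles at once. Only then does \<open>k\<close> grow, and the profiles still have
  mass at least \<open>1 / (p + 1)\<close> beyond \<open>\<rho>\<close>, so
  \<open>\<alpha> k\<close> must be small.\<close>

lemma RM_zero_imp_null:
  assumes \<alpha>: "\<And>k. cmod (\<alpha> k) \<le> S" and T: "series_op peak \<alpha> \<in> RM_zero p"
  shows "\<alpha> \<longlonglongrightarrow> 0"
proof -
  have S: "0 \<le> S"
    using \<alpha>[of 0] norm_ge_zero order_trans by blast
  have "\<forall>\<^sub>F k in sequentially. cmod (\<alpha> k) < x" if "0 < x" for x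
  proof -
    \<comment> \<open>Chosen so that \<open>(p + 1) * (2 powr p * (\<delta> + \<delta>))\<close>
      equals \<open>x powr p / 2\<close>.\<close>
    define \<delta> where "\<delta> = x powr p / (4 * (p + 1) * 2 powr p)"
    have \<delta>: "0 < \<delta>"
      using \<open>0 < x\<close> p by (simp add: \<delta>_def)
    have "((\<lambda>\<rho>. (2 * S * \<epsilon>) powr p * (1 - \<rho>)) \<longlongrightarrow> (2 * S * \<epsilon>) powr p * (1 - 1)) (at_left 1)"
      by (intro tendsto_intros)
    then have "\<forall>\<^sub>F \<rho> in at_left 1. (2 * S * \<epsilon>) powr p * (1 - \<rho>) < \<delta>"
      by (rule order_tendstoD) (use \<delta> in simp)
    moreover have "\<forall>\<^sub>F \<rho> in at_left 1. \<forall>t\<in>{0..<2 * pi}. radial_integral p (series_op peak \<alpha>) \<rho> t \<le> ennreal \<delta>"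
      using T p \<delta> by (subst (asm) RM_zero_iff) auto
    moreover have "\<forall>\<^sub>F \<rho> in at_left 1. \<rho> \<in> {0<..<1::real}"
      by (rule eventually_at_left_real) simp
    ultimately have "\<forall>\<^sub>F \<rho> in at_left 1. (2 * S * \<epsilon>) powr p * (1 - \<rho>) < \<delta> \<and> \<rho> \<in> {0<..<1::real} \<and>
       (\<forall>t\<in>{0..<2 * pi}. radial_integral p (series_op peak \<alpha>) \<rho> t \<le> ennreal \<delta>)"
      by eventually_elim auto
    then obtain \<rho> :: real where \<rho>: "(2 * S * \<epsilon>) powr p * (1 - \<rho>) < \<delta>" "0 < \<rho>" "\<rho> < 1"
      and J: "\<And>t. t \<in> {0..<2 * pi} \<Longrightarrow> radial_integral p (series_op peak \<alpha>) \<rho> t \<le> ennreal \<delta>"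
      by (auto dest!: eventually_happens)
    have "\<forall>\<^sub>F k in sequentially.
      ennreal (1 / (p + 1)) \<le> (\<integral>\<^sup>+ r \<in> {\<rho>..<1}. ennreal (profile k r powr p) \<partial>lborel)"
      using \<rho> by (intro eventually_nn_integral_profile_ge) auto
    then show ?thesis
    proof eventually_elim
      case (elim k)
      obtain \<eta> where "0 < \<eta>"
        and ge: "\<And>t \<rho>. t \<in> {\<theta> k..<\<theta> k + \<eta>} \<Longrightarrow> \<rho> \<in> {0..<1} \<Longrightarrow>
          ennreal (cmod (\<alpha> k) powr p) * (\<integral>\<^sup>+ r \<in> {\<rho>..<1}. ennreal (profile k r powr p) \<partial>lborel) \<le>
          ennreal (2 powr p) * (radial_integral p (series_op peak \<alpha>) \<rho> t + ennreal ((2 * S * \<epsilon>) powr p * (1 - \<rho>)))"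
        using radial_integral_series_ge[of \<alpha> S k, OF \<alpha>] by blast
      have "ennreal (cmod (\<alpha> k) powr p) * ennreal (1 / (p + 1)) \<le>
        ennreal (cmod (\<alpha> k) powr p) * (\<integral>\<^sup>+ r \<in> {\<rho>..<1}. ennreal (profile k r powr p) \<partial>lborel)"
        by (intro mult_left_mono elim) auto
      \<comment> \<open>The bound \<open>J\<close> holds at every angle, so the centre
        \<open>\<theta> k\<close> itself can be used.\<close>
      also have "\<dots> \<le> ennreal (2 powr p) * (radial_integral p (series_op peak \<alpha>) \<rho> (\<theta> k) +
          ennreal ((2 * S * \<epsilon>) powr p * (1 - \<rho>)))"
        using \<rho> \<open>0 < \<eta>\<close> by (intro ge) auto
      also have "\<dots> \<le> ennreal (2 powr p) * (ennreal \<delta> + ennreal \<delta>)"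
        using \<rho> theta[of k] by (intro mult_left_mono add_mono J ennreal_leI) auto
      finally have "cmod (\<alpha> k) powr p * (1 / (p + 1)) \<le> 2 powr p * (\<delta> + \<delta>)"
        using p \<delta> by (simp flip: ennreal_mult ennreal_plus)
      then have "cmod (\<alpha> k) powr p \<le> (p + 1) * (2 powr p * (\<delta> + \<delta>))"
        using p by (simp add: field_simps)
      also have "\<dots> = x powr p / 2"
        using p by (simp add: \<delta>_def divide_simps)
      also have "\<dots> < x powr p"
        using \<open>0 < x\<close> by simp
      finally show ?case
        using p \<open>0 < x\<close> powr_less_cancel2[of p "cmod (\<alpha> k)" x] by (cases "\<alpha> k = 0") auto
    qed
  qed
  then show ?thesis
    by (auto simp: tendsto_iff)
qed

end

subsection \<open>Existence of radial peaks\<close>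

text \<open>By the parallelogram law, distance at least \<open>\<delta>\<close> from
  \<open>w\<close> forces \<open>cmod (w + z) / 2\<close> below a fixed \<open>q < 1\<close>. The
  factor \<open>n powr (1 / p)\<close> is at most \<open>n\<close>, and \<open>n * q ^ n\<close>
  tends to 0.\<close>

lemma exists_decaying_power:
  fixes p b \<delta> :: real and w :: complex
  assumes p: "1 \<le> p" and b: "0 < b" and \<delta>: "0 < \<delta>" "\<delta> \<le> 2" and w: "cmod w = 1"
  shows "\<exists>n>k. \<forall>z. cmod z \<le> 1 \<longrightarrow> \<delta> \<le> dist z w \<longrightarrow>
    real n powr (1 / p) * (cmod (w + z) / 2) ^ n \<le> b"
proof -
  define q where "q = sqrt (1 - (\<delta> / 2)\<^sup>2)"
  have "(\<delta> / 2)\<^sup>2 \<le> 1"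
    using \<delta> by (intro power_le_one) auto
  then have q: "0 \<le> q" "q < 1"
    using \<delta> by (auto simp: q_def)
  have le: "cmod (w + z) / 2 \<le> q" if "cmod z \<le> 1" "\<delta> \<le> dist z w" for z
    unfolding q_def
  proof (rule real_le_rsqrt)
    have "(cmod (w + z))\<^sup>2 + (dist z w)\<^sup>2 = 2 * (cmod w)\<^sup>2 + 2 * (cmod z)\<^sup>2"
      unfolding dist_norm cmod_power2 by (simp add: power2_eq_square algebra_simps)
    moreover have "(cmod z)\<^sup>2 \<le> 1" "\<delta>\<^sup>2 \<le> (dist z w)\<^sup>2"
      using that \<delta> by (auto intro: power_le_one power_mono)
    ultimately show "(cmod (w + z) / 2)\<^sup>2 \<le> 1 - (\<delta> / 2)\<^sup>2"
      using w by (simp add: power_divide)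
  qed
  have "(\<lambda>n. real n * q ^ n) \<longlonglongrightarrow> 0"
    using q by (intro powser_times_n_limit_0) auto
  then have "\<forall>\<^sub>F n in sequentially. real n * q ^ n < b"
    by (rule order_tendstoD) (rule b)
  then have "\<forall>\<^sub>F n in sequentially. k < n \<and> real n * q ^ n < b"
    by (intro eventually_conj eventually_gt_at_top)
  then obtain n where n: "k < n" "real n * q ^ n < b"
    by (auto dest!: eventually_happens)
  have "real n powr (1 / p) * (cmod (w + z) / 2) ^ n \<le> b" if "cmod z \<le> 1" "\<delta> \<le> dist z w" for z
  proof -
    have "real n powr (1 / p) \<le> real n powr 1"
      using n p by (intro powr_mono) auto
    then have "real n powr (1 / p) * (cmod (w + z) / 2) ^ n \<le> real n * q ^ n"
      using le[OF that] by (intro mult_mono power_mono) auto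
    with n show ?thesis
      by linarith
  qed
  with n show ?thesis
    by blast
qed

text \<open>The centres have imaginary parts \<open>y k\<close>, halving at each step. For
  \<open>j < k\<close> the heights differ by at least \<open>y j / 2\<close>, while
  \<open>2 * d j + 2 * d k\<close> is at most \<open>3 * y j / 8\<close>. The powers
  \<open>n k\<close> are chosen last, depending on \<open>d\<close> and \<open>e\<close>.\<close>

lemma exists_radial_peaks:
  assumes p: "1 \<le> p"
  shows "\<exists>\<epsilon> \<theta> d e n. radial_peaks p \<epsilon> \<theta> d e n"
proof -
  define \<epsilon> where "\<epsilon> = 1 / (8 * (p + 1))"
  define y where "y k = (1 / 2 :: real) ^ k" for k
  define \<theta> where "\<theta> k = arcsin (y k)" for k
  define d where "d k = y k / 8" for k
  define e where "e k = \<epsilon> * (1 / 2) ^ Suc k" for k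
  have y: "0 < y k" "y k \<le> 1" for k
    by (auto simp: y_def power_le_one)
  have \<epsilon>: "0 < \<epsilon>" "8 * (p + 1) * \<epsilon> = 1"
    using p by (auto simp: \<epsilon>_def)
  have "\<exists>m>k. \<forall>z. cmod z \<le> 1 \<longrightarrow> d k \<le> dist z (cis (\<theta> k)) \<longrightarrow>
      real m powr (1 / p) * (cmod (cis (\<theta> k) + z) / 2) ^ m \<le> e k" for k
    using p \<epsilon> y[of k] by (intro exists_decaying_power) (auto simp: d_def e_def)
  then obtain n where n: "\<And>k. k < n k" "\<And>k z. cmod z \<le> 1 \<Longrightarrow> d k \<le> dist z (cis (\<theta> k)) \<Longrightarrow>
      real (n k) powr (1 / p) * (cmod (cis (\<theta> k) + z) / 2) ^ n k \<le> e k"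
    by metis
  have sep: "2 * d j + 2 * d k \<le> dist (cis (\<theta> j)) (cis (\<theta> k))" if "j < k" for j k
  proof -
    have "Im (cis (\<theta> i)) = y i" for i
      using y[of i] by (simp add: \<theta>_def)
    then have "\<bar>y j - y k\<bar> \<le> dist (cis (\<theta> j)) (cis (\<theta> k))"
      using abs_Im_le_cmod[of "cis (\<theta> j) - cis (\<theta> k)"] by (simp add: dist_norm)
    moreover have "y k \<le> y j / 2"
      using power_decreasing[of "Suc j" k "1 / 2 :: real"] that by (simp add: y_def)
    ultimately show ?thesis
      using y[of j] by (simp add: d_def)
  qed
  have "radial_peaks p \<epsilon> \<theta> d e n"
  proof
    fix k
    have "0 \<le> \<theta> k" "\<theta> k \<le> pi / 2"
      using y[of k] arcsin_le_arcsin[of 0 "y k"] arcsin_ubound[of "y k"] by (auto simp: \<theta>_def)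
    then show "0 \<le> \<theta> k" "\<theta> k < 2 * pi"
      using pi_gt_zero by linarith+
    show "0 < d k"
      using y[of k] by (simp add: d_def)
    show "0 \<le> e k"
      using \<epsilon> by (simp add: e_def)
    show "2 * d j + 2 * d k \<le> dist (cis (\<theta> j)) (cis (\<theta> k))" if "j \<noteq> k" for j
      using sep[of j k] sep[of k j] that by (cases j k rule: linorder_cases) (auto simp: dist_commute)
  next
    have "(\<lambda>k. y k / 8) \<longlonglongrightarrow> 0 / 8"
      unfolding y_def by (intro tendsto_divide LIMSEQ_realpow_zero tendsto_const) auto
    then show "d \<longlonglongrightarrow> 0"
      by (simp add: d_def[abs_def])
    show "e sums \<epsilon>"
      using sums_mult[OF power_half_series, of \<epsilon>] by (simp add: e_def[abs_def])
  qed (use p \<epsilon> n in auto)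
  then show ?thesis
    by blast
qed

subsection \<open>The isomorphism with bounded sequences\<close>

lemma norm_le_ell_inf_norm: "\<alpha> \<in> ell_inf \<Longrightarrow> cmod (\<alpha> k) \<le> ell_inf_norm \<alpha>"
  by (auto simp: ell_inf_def ell_inf_norm_def bounded_iff intro!: cSUP_upper bdd_aboveI2)

lemma ell_inf_subspace: "cfun.subspace ell_inf"
proof (rule cfun.subspaceI)
  show "0 \<in> ell_inf"
    by (auto simp: ell_inf_def bounded_iff)
  show "x + y \<in> ell_inf" if "x \<in> ell_inf" "y \<in> ell_inf" for x y
    using that bounded_plus_comp[of x UNIV y] by (simp add: ell_inf_def plus_fun_def)
  show "fun_scale c x \<in> ell_inf" if "x \<in> ell_inf" for c x
  proof -
    from that obtain B where "\<And>k. cmod (x k) \<le> B"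
      by (auto simp: ell_inf_def bounded_iff)
    then have "cmod (fun_scale c x k) \<le> cmod c * B" for k
      by (simp add: fun_scale_def norm_mult mult_left_mono)
    then show ?thesis
      unfolding ell_inf_def bounded_iff by blast
  qed
qed

lemma c_null_subset: "c_null \<subseteq> ell_inf"
  using convergent_imp_bounded by (auto simp: c_null_def ell_inf_def)

context radial_peaks
begin

lemma series_op_linear: "linear_on_set ell_inf (series_op peak)"
  unfolding linear_on_set_def
proof (intro conjI ballI allI)
  have sm: "summable (\<lambda>k. \<alpha> k * peak k z)" if "\<alpha> \<in> ell_inf" for \<alpha> z
    by (rule summable_series) (rule norm_le_ell_inf_norm[OF that])
  show "series_op peak (\<alpha> + \<beta>) = series_op peak \<alpha> + series_op peak \<beta>"
    if "\<alpha> \<in> ell_inf" "\<beta> \<in> ell_inf" for \<alpha> \<beta>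
    using sm[OF that(1)] sm[OF that(2)]
    by (auto simp: series_op_def plus_fun_def suminf_add distrib_right)
  show "series_op peak (fun_scale c \<alpha>) = fun_scale c (series_op peak \<alpha>)"
    if "\<alpha> \<in> ell_inf" for c \<alpha>
    using sm[OF that] by (auto simp: series_op_def fun_scale_def suminf_mult mult.assoc)
qed

lemma series_op_subspace: "cfun.subspace (series_op peak ` ell_inf)"
proof -
  have add: "\<forall>\<alpha>\<in>ell_inf. \<forall>\<beta>\<in>ell_inf. series_op peak (\<alpha> + \<beta>) = series_op peak \<alpha> + series_op peak \<beta>"
    and scale: "\<forall>c. \<forall>\<alpha>\<in>ell_inf. series_op peak (fun_scale c \<alpha>) = fun_scale c (series_op peak \<alpha>)"
    using series_op_linear by (auto simp: linear_on_set_def)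
  show ?thesis
  proof (rule cfun.subspaceI)
    have "0 = series_op peak 0"
      by (auto simp: series_op_def)
    then show "0 \<in> series_op peak ` ell_inf"
      using cfun.subspace_0[OF ell_inf_subspace] by blast
    fix f g
    assume "f \<in> series_op peak ` ell_inf" "g \<in> series_op peak ` ell_inf"
    then obtain \<alpha> \<beta> where "\<alpha> \<in> ell_inf" "f = series_op peak \<alpha>" "\<beta> \<in> ell_inf" "g = series_op peak \<beta>"
      by blast
    then have "f + g = series_op peak (\<alpha> + \<beta>)" "\<alpha> + \<beta> \<in> ell_inf"
      using add cfun.subspace_add[OF ell_inf_subspace] by simp_all
    then show "f + g \<in> series_op peak ` ell_inf"
      by blast
  next
    fix f c
    assume "f \<in> series_op peak ` ell_inf"
    then obtain \<alpha> where "\<alpha> \<in> ell_inf" "f = series_op peak \<alpha>"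
      by blast
    then have "fun_scale c f = series_op peak (fun_scale c \<alpha>)" "fun_scale c \<alpha> \<in> ell_inf"
      using scale cfun.subspace_scale[OF ell_inf_subspace] by simp_all
    then show "fun_scale c f \<in> series_op peak ` ell_inf"
      by blast
  qed
qed

lemma norm_series_le:
  assumes "\<alpha> \<in> ell_inf"
  shows "RM_inf_norm p (series_op peak \<alpha>) \<le> (3 * 2 powr p) powr (1 / p) * ell_inf_norm \<alpha>"
proof -
  have "0 \<le> ell_inf_norm \<alpha>"
    using norm_le_ell_inf_norm[OF assms, of 0] norm_ge_zero order_trans by blast
  then show ?thesis
    unfolding RM_inf_norm_def
    by (intro enn2real_leI rho_inf_series_le norm_le_ell_inf_norm assms) auto
qed

lemma series_op_inj: "inj_on (series_op peak) ell_inf"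
proof
  fix \<alpha> \<beta>
  assume \<alpha>\<beta>: "\<alpha> \<in> ell_inf" "\<beta> \<in> ell_inf" and eq: "series_op peak \<alpha> = series_op peak \<beta>"
  define \<gamma> where "\<gamma> = \<alpha> - \<beta>"
  have mem: "\<gamma> \<in> ell_inf"
    using cfun.subspace_diff[OF ell_inf_subspace \<alpha>\<beta>] by (simp add: \<gamma>_def)
  \<comment> \<open>Here \<open>\<gamma> + \<beta>\<close> is \<open>\<alpha>\<close>, so additivity
    alone puts the difference into the kernel; the lower norm bound then makes it vanish.\<close>
  have "series_op peak (\<gamma> + \<beta>) = series_op peak \<gamma> + series_op peak \<beta>"
    using series_op_linear \<alpha>\<beta> mem unfolding linear_on_set_def by blast
  then have "series_op peak \<gamma> = 0"
    using eq by (simp add: \<gamma>_def)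
  also have "0 = series_op peak (\<lambda>k. 0)"
    by (auto simp: series_op_def)
  \<comment> \<open>The norm of the zero function is read off from the upper estimate with
    \<open>S = 0\<close>.\<close>
  finally have "rho_inf p (series_op peak \<gamma>) \<le> ennreal ((3 * 2 powr p) powr (1 / p) * 0)"
    using rho_inf_series_le[of "\<lambda>k. 0" 0] by simp
  then have "RM_inf_norm p (series_op peak \<gamma>) = 0"
    by (simp add: RM_inf_norm_def)
  then have "ell_inf_norm \<gamma> \<le> 0"
    using norm_series_ge[OF mem] by simp
  then have "cmod (\<gamma> k) \<le> 0" for k
    using norm_le_ell_inf_norm[OF mem, of k] by linarith
  then show "\<alpha> = \<beta>"
    by (auto simp: \<gamma>_def fun_eq_iff)
qed

lemma series_op_isomorphism:
  "normed_isomorphism ell_inf ell_inf_norm (series_op peak ` ell_inf) (RM_inf_norm p) (series_op peak)"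
  unfolding normed_isomorphism_def
proof (intro conjI)
  show "bij_betw (series_op peak) ell_inf (series_op peak ` ell_inf)"
    using series_op_inj by (simp add: bij_betw_def)
  show "bounded_on_set ell_inf ell_inf_norm (RM_inf_norm p) (series_op peak)"
    unfolding bounded_on_set_def using norm_series_le by blast
  show "bounded_on_set (series_op peak ` ell_inf) (RM_inf_norm p) ell_inf_norm (inv_into ell_inf (series_op peak))"
    unfolding bounded_on_set_def using norm_series_ge by (auto simp: inv_into_f_f[OF series_op_inj])
qed (rule series_op_linear)

lemma series_op_RM_zero_iff:
  assumes "\<alpha> \<in> ell_inf"
  shows "series_op peak \<alpha> \<in> RM_zero p \<longleftrightarrow> \<alpha> \<in> c_null"
  using series_op_RM_zero[of \<alpha>, OF norm_le_ell_inf_norm[OF assms]]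
    RM_zero_imp_null[of \<alpha>, OF norm_le_ell_inf_norm[OF assms]]
  by (auto simp: c_null_def)

text \<open>The operator sends the \<open>k\<close>-th unit sequence, which is null, to
  \<open>peak k\<close>.\<close>

lemma peak_RM_zero: "peak k \<in> RM_zero p"
proof -
  define \<delta> where "\<delta> j = (if j = k then 1 else 0 :: complex)" for j
  have "\<forall>\<^sub>F j in sequentially. \<delta> j = 0"
    using eventually_gt_at_top[of k] by eventually_elim (simp add: \<delta>_def)
  then have "\<delta> \<in> c_null"
    by (simp add: c_null_def tendsto_eventually)
  then have "series_op peak \<delta> \<in> RM_zero p"
    using c_null_subset by (subst series_op_RM_zero_iff) auto
  moreover have "series_op peak \<delta> = peak k"
  proof
    fix z
    have "(\<lambda>j. \<delta> j * peak j z) = (\<lambda>j. if j = k then peak j z else 0)"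
      by (auto simp: \<delta>_def)
    then show "series_op peak \<delta> z = peak k z"
      using sums_single[of k "\<lambda>j. peak j z"] by (simp add: series_op_def sums_iff)
  qed
  ultimately show ?thesis
    by simp
qed

end

theorem theorem2p18:
  fixes p :: real
  assumes "1 \<le> p"
  shows "\<exists>f :: nat \<Rightarrow> complex \<Rightarrow> complex.
    (\<forall>k. f k \<in> RM_zero p) \<and>
    (\<forall>\<alpha>\<in>ell_inf. \<forall>K. compact K \<and> K \<subseteq> ball 0 1 \<longrightarrow>
       uniform_limit K (\<lambda>n z. \<Sum>k<n. \<alpha> k * f k z) (series_op f \<alpha>) sequentially) \<and>
    series_op f ` ell_inf \<subseteq> RM_inf p \<and>
    cfun.subspace (series_op f ` ell_inf) \<and>
    normed_isomorphism ell_inf ell_inf_norm (series_op f ` ell_inf) (RM_inf_norm p) (series_op f) \<and>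
    (\<forall>\<alpha>\<in>ell_inf. series_op f \<alpha> \<in> RM_zero p \<longleftrightarrow> \<alpha> \<in> c_null) \<and>
    (\<lambda>z. \<Sum>k. f k z) \<in> RM_inf p - RM_zero p"
proof -
  obtain \<epsilon> \<theta> d e n where "radial_peaks p \<epsilon> \<theta> d e n"
    using exists_radial_peaks[OF assms] by blast
  then interpret radial_peaks p \<epsilon> \<theta> d e n .
  have RM_inf: "series_op peak \<alpha> \<in> RM_inf p" if "\<alpha> \<in> ell_inf" for \<alpha>
    by (rule series_op_RM_inf) (rule norm_le_ell_inf_norm[OF that])
  \<comment> \<open>The constant sequence 1 is bounded but not null, which settles the claim on the
    sum of all peaks.\<close>
  have one: "(\<lambda>k. 1) \<in> ell_inf" "(\<lambda>k. 1) \<notin> c_null"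
    by (auto simp: ell_inf_def c_null_def LIMSEQ_const_iff)
  have "(\<lambda>z. \<Sum>k. peak k z) = series_op peak (\<lambda>k. 1)"
    by (simp add: series_op_def)
  with one have "(\<lambda>z. \<Sum>k. peak k z) \<in> RM_inf p - RM_zero p"
    using RM_inf series_op_RM_zero_iff by simp
  moreover have "uniform_limit K (\<lambda>n z. \<Sum>k<n. \<alpha> k * peak k z) (series_op peak \<alpha>) sequentially"
    if "\<alpha> \<in> ell_inf" "compact K" "K \<subseteq> ball 0 1" for \<alpha> K
    by (rule uniform_limit_series[OF norm_le_ell_inf_norm[OF that(1)] that(2,3)])
  ultimately show ?thesis
    using peak_RM_zero RM_inf series_op_subspace series_op_isomorphism series_op_RM_zero_iff
    by (intro exI[of _ peak]) blast
qed

end
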